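(* Let $L\ge 3$ be an integer, $\alpha,\sigma\in[-1,1]$, $\gamma\in[0,1]$, $p_\lambda\in[0,1/2]$, and $f_{cl},f_{a\text{-}cl}\ge 0$ with $f_{cl}+f_{a\text{-}cl}\le 1$. Consider the system for nonnegative variables $R_k,Q_k,U_k$, $k=0,\dots,L$, with $\sum_kR_k=1-f_{cl}-f_{a\text{-}cl}$, $\sum_kQ_k=f_{cl}$, $\sum_kU_k=f_{a\text{-}cl}$, consisting of the equations $$\frac{dX_0}{dt}=-X_0e_0+X_1(1-e_1),\qquad \frac{dX_L}{dt}=X_{L-1}e_{L-1}-X_L(1-e_L),$$ $$\frac{dX_k}{dt}=X_{k-1}e_{k-1}-X_k+X_{k+1}(1-e_{k+1}),\qquad k=1,\dots,L-1,$$ for each of the three choices $(X,e)=(R,e^{(reg)})$, $(X,e)=(Q,e^{(cl)})$, $(X,e)=(U,e^{(a\text{-}cl)})$, where $e_k^{(reg)},e_k^{(cl)},e_k^{(a\text{-}cl)}$ are the functions of the phase variables defined in the context. The system has equilibria at which $R_L=1-f_{cl}-f_{a\text{-}cl}-R_0$, $R_0\in[0,1-f_{cl}-f_{a\text{-}cl}]$, $Q_0=f_{cl}$, $U_0=f_{a\text{-}cl}$, and all the other phase variables are equal to zero; that is, for every $R_0\in[0,1-f_{cl}-f_{a\text{-}cl}]$ this point is an equilibrium (all right-hand sides vanish there). At these equilibria $p_c=1$.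
   Context: Reputation levels are $r_k=k/L$, $k=0,\dots,L$. $R_k$, $Q_k$, $U_k$ are the proportions (of the whole community) of regular, clique and anti-clique members, respectively, with reputation $r_k$; $f_{cl}$ and $f_{a\text{-}cl}$ are the fractions of clique and anti-clique members. Put $a_k=r_k(1+\alpha(1-r_k))$ and $c_k=r_k(1+\sigma(1-r_k))$. Documents have type $g$ (generic), $q$ (supporting the clique) or $\bar q$ (contradicting the clique), and are authentic ($A$) or fake ($F$). Selection probabilities: with $D=\sum_{i=0}^Lr_i(R_i+Q_i+U_i)$, $s_k^{(reg)}=r_kR_k/D$, $s_k^{(cl)}=r_kQ_k/D$, $s_k^{(a\text{-}cl)}=r_kU_k/D$ (no separate convention is specified for $D=0$). Individual probabilities of correct evaluation of authentic documents ($p_{c,ind}$) and of mistaken evaluation of fake documents as authentic ($p_{m,ind}$), all sums over $k=0,\dots,L$: $p_{c,ind}(g,A)=\sum s_k^{(reg)}c_k+\tfrac12\sum(s_k^{(cl)}+s_k^{(a\text{-}cl)})$, $p_{m,ind}(g,F)=\sum s_k^{(reg)}(1-c_k)+\tfrac12\sum(s_k^{(cl)}+s_k^{(a\text{-}cl)})$, $p_{c,ind}(q,A)=\sum s_k^{(reg)}c_k+\sum s_k^{(cl)}$, $\;p_{m,ind}(q,F)=\sum s_k^{(reg)}(1-c_k)+\sum s_k^{(cl)}$, $p_{c,ind}(\bar q,A)=\sum s_k^{(reg)}c_k+\sum s_k^{(a\text{-}cl)}$, $\;p_{m,ind}(\bar q,F)=\sum s_k^{(reg)}(1-c_k)+\sum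 s_k^{(a\text{-}cl)}$. Majority-of-three probabilities: for each type $x\in\{g,q,\bar q\}$, $p_c(x,A)=p_{c,ind}(x,A)^2\,(3-2p_{c,ind}(x,A))$ and $p_m(x,F)=p_{m,ind}(x,F)^2\,(3-2p_{m,ind}(x,F))$. Probabilities that a submitted document is evaluated as authentic: $e_k^{(reg)}=(1-2p_\lambda)[a_kp_c(g,A)+(1-a_k)p_m(g,F)]+p_\lambda[a_kp_c(q,A)+(1-a_k)p_m(q,F)]+p_\lambda[a_kp_c(\bar q,A)+(1-a_k)p_m(\bar q,F)]$, $e_k^{(cl)}=\gamma a_kp_c(q,A)+(1-\gamma a_k)p_m(q,F)$, $e_k^{(a\text{-}cl)}=\gamma a_kp_c(\bar q,A)+(1-\gamma a_k)p_m(\bar q,F)$. Overall probability of correct document evaluation: $p_c=\sum_{x\in\{g,q,\bar q\}}\big[Prob(x,A)\,p_c(x,A)+Prob(x,F)\,(1-p_m(x,F))\big]$, where $Prob(g,A)=(1-2p_\lambda)\sum R_ka_k$, $\;Prob(g,F)=(1-2p_\lambda)\sum R_k(1-a_k)$, $Prob(q,A)=p_\lambda\sum R_ka_k+\sum Q_k\gamma a_k$, $\;Prob(q,F)=p_\lambda\sum R_k(1-a_k)+\sum Q_k(1-\gamma a_k)$, $Prob(\bar q,A)=p_\lambda\sum R_ka_k+\sum U_k\gamma a_k$, $\;Prob(\bar q,F)=p_\lambda\sum R_k(1-a_k)+\sum U_k(1-\gamma a_k)$. *)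

theory Defs imports Complex_Main begin

record params =
  levels :: nat              \<comment> \<open>the integer \<open>L\<close>\<close>
  alpha :: real
  sigma :: real
  gamma :: real
  p_lambda :: real
  frac_cl :: real            \<comment> \<open>\<open>f\<^sub>c\<^sub>l\<close>\<close>
  frac_acl :: real           \<comment> \<open>\<open>f\<^sub>a\<^sub>-\<^sub>c\<^sub>l\<close>\<close>

text \<open>The conditions on \<open>L\<close>, \<open>\<alpha>\<close>, \<open>\<sigma>\<close>, \<open>\<gamma>\<close>, \<open>p\<^sub>\<lambda>\<close> and the fractions are not built into
  this type.\<close>

datatype member = Regular | Clique | AntiClique

datatype doc_type = Generic | Supporting | Contradicting
  \<comment> \<open>the types \<open>g\<close>, \<open>q\<close> and \<open>q\<close>-bar\<close>

text \<open>A state \<open>x\<close> collects the phase variables: \<open>x Regular k\<close>, \<open>x Clique k\<close> and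
  \<open>x AntiClique k\<close> are \<open>R\<^sub>k\<close>, \<open>Q\<^sub>k\<close> and \<open>U\<^sub>k\<close>. Only the values at \<open>k \<le> L\<close> are used.\<close>

type_synonym state = "member \<Rightarrow> nat \<Rightarrow> real"

definition rep :: "params \<Rightarrow> nat \<Rightarrow> real" where
  "rep P k = real k / real (levels P)"

definition a_coeff :: "params \<Rightarrow> nat \<Rightarrow> real" where
  "a_coeff P k = rep P k * (1 + alpha P * (1 - rep P k))"

definition c_coeff :: "params \<Rightarrow> nat \<Rightarrow> real" where
  "c_coeff P k = rep P k * (1 + sigma P * (1 - rep P k))"

definition total_rep :: "params \<Rightarrow> state \<Rightarrow> real" where
  "total_rep P x = (\<Sum>i=0..levels P. rep P i * (x Regular i + x Clique i + x AntiClique i))"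

text \<open>If \<open>total_rep P x = 0\<close> (every member has reputation 0) then all selection
  probabilities are 0, since division by zero yields 0: nobody can be selected as an evaluator.\<close>

definition sel :: "params \<Rightarrow> state \<Rightarrow> member \<Rightarrow> nat \<Rightarrow> real" where
  "sel P x m k = rep P k * x m k / total_rep P x"

text \<open>\<open>p_c_ind\<close>, \<open>p_c_doc\<close> refer to authentic documents evaluated correctly;
  \<open>p_m_ind\<close>, \<open>p_m_doc\<close> to fake documents evaluated, by mistake, as authentic.\<close>

primrec p_c_ind :: "params \<Rightarrow> state \<Rightarrow> doc_type \<Rightarrow> real" where
  "p_c_ind P x Generic =
     (\<Sum>k=0..levels P. sel P x Regular k * c_coeff P k)
     + 1/2 * (\<Sum>k=0..levels P. sel P x Clique k + sel P x AntiClique k)"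
| "p_c_ind P x Supporting =
     (\<Sum>k=0..levels P. sel P x Regular k * c_coeff P k)
     + (\<Sum>k=0..levels P. sel P x Clique k)"
| "p_c_ind P x Contradicting =
     (\<Sum>k=0..levels P. sel P x Regular k * c_coeff P k)
     + (\<Sum>k=0..levels P. sel P x AntiClique k)"

primrec p_m_ind :: "params \<Rightarrow> state \<Rightarrow> doc_type \<Rightarrow> real" where
  "p_m_ind P x Generic =
     (\<Sum>k=0..levels P. sel P x Regular k * (1 - c_coeff P k))
     + 1/2 * (\<Sum>k=0..levels P. sel P x Clique k + sel P x AntiClique k)"
| "p_m_ind P x Supporting =
     (\<Sum>k=0..levels P. sel P x Regular k * (1 - c_coeff P k))
     + (\<Sum>k=0..levels P. sel P x Clique k)"
| "p_m_ind P x Contradicting =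
     (\<Sum>k=0..levels P. sel P x Regular k * (1 - c_coeff P k))
     + (\<Sum>k=0..levels P. sel P x AntiClique k)"

text \<open>\<open>p\<^sup>2(3 - 2p)\<close> is the probability that at least two of three independent evaluators
  vote a certain way when each of them does so with probability \<open>p\<close>.\<close>

definition p_c_doc :: "params \<Rightarrow> state \<Rightarrow> doc_type \<Rightarrow> real" where
  "p_c_doc P x d = (p_c_ind P x d)^2 * (3 - 2 * p_c_ind P x d)"

definition p_m_doc :: "params \<Rightarrow> state \<Rightarrow> doc_type \<Rightarrow> real" where
  "p_m_doc P x d = (p_m_ind P x d)^2 * (3 - 2 * p_m_ind P x d)"

primrec e_prob :: "params \<Rightarrow> state \<Rightarrow> member \<Rightarrow> nat \<Rightarrow> real" where
  "e_prob P x Regular k =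
     (1 - 2 * p_lambda P) *
       (a_coeff P k * p_c_doc P x Generic + (1 - a_coeff P k) * p_m_doc P x Generic)
     + p_lambda P *
       (a_coeff P k * p_c_doc P x Supporting + (1 - a_coeff P k) * p_m_doc P x Supporting)
     + p_lambda P *
       (a_coeff P k * p_c_doc P x Contradicting + (1 - a_coeff P k) * p_m_doc P x Contradicting)"
| "e_prob P x Clique k =
     gamma P * a_coeff P k * p_c_doc P x Supporting
     + (1 - gamma P * a_coeff P k) * p_m_doc P x Supporting"
| "e_prob P x AntiClique k =
     gamma P * a_coeff P k * p_c_doc P x Contradicting
     + (1 - gamma P * a_coeff P k) * p_m_doc P x Contradicting"

primrec prob_A :: "params \<Rightarrow> state \<Rightarrow> doc_type \<Rightarrow> real" where
  "prob_A P x Generic =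
     (1 - 2 * p_lambda P) * (\<Sum>k=0..levels P. x Regular k * a_coeff P k)"
| "prob_A P x Supporting =
     p_lambda P * (\<Sum>k=0..levels P. x Regular k * a_coeff P k)
     + (\<Sum>k=0..levels P. x Clique k * (gamma P * a_coeff P k))"
| "prob_A P x Contradicting =
     p_lambda P * (\<Sum>k=0..levels P. x Regular k * a_coeff P k)
     + (\<Sum>k=0..levels P. x AntiClique k * (gamma P * a_coeff P k))"

primrec prob_F :: "params \<Rightarrow> state \<Rightarrow> doc_type \<Rightarrow> real" where
  "prob_F P x Generic =
     (1 - 2 * p_lambda P) * (\<Sum>k=0..levels P. x Regular k * (1 - a_coeff P k))"
| "prob_F P x Supporting =
     p_lambda P * (\<Sum>k=0..levels P. x Regular k * (1 - a_coeff P k))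
     + (\<Sum>k=0..levels P. x Clique k * (1 - gamma P * a_coeff P k))"
| "prob_F P x Contradicting =
     p_lambda P * (\<Sum>k=0..levels P. x Regular k * (1 - a_coeff P k))
     + (\<Sum>k=0..levels P. x AntiClique k * (1 - gamma P * a_coeff P k))"

definition p_correct :: "params \<Rightarrow> state \<Rightarrow> real" where
  "p_correct P x = (\<Sum>d\<in>{Generic, Supporting, Contradicting}.
     prob_A P x d * p_c_doc P x d + prob_F P x d * (1 - p_m_doc P x d))"

text \<open>The right-hand side of the equation for \<open>x m k\<close>, meaningful for \<open>k \<le> L\<close>.\<close>

definition rhs :: "params \<Rightarrow> state \<Rightarrow> member \<Rightarrow> nat \<Rightarrow> real" where
  "rhs P x m k =
     (if k = 0 then
        - x m 0 * e_prob P x m 0 + x m 1 * (1 - e_prob P x m 1)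
      else if k = levels P then
        x m (k - 1) * e_prob P x m (k - 1) - x m k * (1 - e_prob P x m k)
      else
        x m (k - 1) * e_prob P x m (k - 1) - x m k + x m (k + 1) * (1 - e_prob P x m (k + 1)))"

definition phase_space :: "params \<Rightarrow> state set" where
  "phase_space P = {x.
     (\<forall>m. \<forall>k\<le>levels P. 0 \<le> x m k) \<and>
     (\<Sum>k=0..levels P. x Regular k) = 1 - frac_cl P - frac_acl P \<and>
     (\<Sum>k=0..levels P. x Clique k) = frac_cl P \<and>
     (\<Sum>k=0..levels P. x AntiClique k) = frac_acl P}"

definition is_equilibrium :: "params \<Rightarrow> state \<Rightarrow> bool" where
  "is_equilibrium P x \<longleftrightarrow> x \<in> phase_space P \<and> (\<forall>m. \<forall>k\<le>levels P. rhs P x m k = 0)"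

end

theory Submission imports Defs begin

text \<open>Reputation-0 members are never selected as evaluators, so all selected evaluators are regular
  members of reputation 1, who never err; members of reputation 0 only submit fake documents, which
  are always rejected. If nobody has positive reputation, all selection probabilities are 0, hence
  every document is evaluated as fake; this is correct because nobody submits authentic ones.\<close>

lemma sum_endpoints:
  fixes f :: "nat \<Rightarrow> 'a::comm_monoid_add"
  assumes "0 < n" and "\<And>k. 0 < k \<Longrightarrow> k < n \<Longrightarrow> f k = 0"
  shows "(\<Sum>k=0..n. f k) = f 0 + f n"
proof -
  have "(\<Sum>k=0..n. f k) = (\<Sum>k\<in>{0, n}. f k)"
    using assms by (intro sum.mono_neutral_right) auto
  then show ?thesis
    using assms(1) by simp
qed

lemma rep_0 [simp]: "rep P 0 = 0"
  by (simp add: rep_def)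

lemma rep_levels [simp]: "0 < levels P \<Longrightarrow> rep P (levels P) = 1"
  by (simp add: rep_def)

lemma a_coeff_0 [simp]: "a_coeff P 0 = 0"
  by (simp add: a_coeff_def)

lemma a_coeff_levels [simp]: "0 < levels P \<Longrightarrow> a_coeff P (levels P) = 1"
  by (simp add: a_coeff_def)

lemma c_coeff_levels [simp]: "0 < levels P \<Longrightarrow> c_coeff P (levels P) = 1"
  by (simp add: c_coeff_def)

text \<open>This fixes only the pattern of zeros: regular mass at the two extreme levels, all other
  mass at level 0. The actual values enter in the final theorem.\<close>

locale extreme_state =
  fixes P :: params and x :: state
  assumes levels_pos: "0 < levels P"
    and interior: "0 < k \<Longrightarrow> k < levels P \<Longrightarrow> x m k = 0"
    and top: "m \<noteq> Regular \<Longrightarrow> x m (levels P) = 0"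
begin

lemma sum_state:
  "(\<Sum>k=0..levels P. x m k * f k) = x m 0 * f 0 + x m (levels P) * f (levels P)"
  using levels_pos interior by (intro sum_endpoints) auto

lemma total_rep_eq: "total_rep P x = x Regular (levels P)"
  unfolding total_rep_def using levels_pos interior top
  by (subst sum_endpoints) auto

text \<open>By \<open>total_rep_eq\<close>, the only numerator that can survive equals the
  denominator, so the quotient is 1, or 0 if both vanish.\<close>

lemma sel_eq:
  assumes "k \<le> levels P"
  shows "sel P x m k = (if m = Regular \<and> k = levels P \<and> x Regular k \<noteq> 0 then 1 else 0)"
proof -
  consider "k = 0" | "0 < k" "k < levels P" | "k = levels P"
    using assms by linarith
  then show ?thesis
    by cases (use levels_pos in \<open>auto simp: sel_def interior top total_rep_eq\<close>)
qed

lemma p_c_ind_eq: "p_c_ind P x d = (if x Regular (levels P) = 0 then 0 else 1)"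
proof -
  have "(\<Sum>k=0..levels P. sel P x Regular k * c_coeff P k)
      = (if x Regular (levels P) = 0 then 0 else 1)"
    using levels_pos by (subst sum_endpoints) (auto simp: sel_eq)
  then show ?thesis
    by (cases d) (simp_all add: sel_eq)
qed

text \<open>The factor \<open>1 - c_coeff P k\<close> vanishes at the top level, the only one that
  can be selected.\<close>

lemma p_m_ind_eq: "p_m_ind P x d = 0"
proof -
  have "(\<Sum>k=0..levels P. sel P x Regular k * (1 - c_coeff P k)) = 0"
    using levels_pos by (subst sum_endpoints) (auto simp: sel_eq)
  then show ?thesis
    by (cases d) (simp_all add: sel_eq)
qed

lemma p_c_doc_eq: "p_c_doc P x d = (if x Regular (levels P) = 0 then 0 else 1)"
  by (simp add: p_c_doc_def p_c_ind_eq)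

lemma p_m_doc_eq: "p_m_doc P x d = 0"
  by (simp add: p_m_doc_def p_m_ind_eq)

lemma e_prob_0: "e_prob P x m 0 = 0"
  by (cases m) (simp_all add: p_m_doc_eq)

text \<open>Here \<open>a_coeff\<close> is 1 and the three document-type weights add up to 1. The
  premise rules out the case \<open>p_c_doc P x d = 0\<close>.\<close>

lemma e_prob_levels:
  "x Regular (levels P) \<noteq> 0 \<Longrightarrow> e_prob P x Regular (levels P) = 1"
  using levels_pos by (simp add: p_m_doc_eq p_c_doc_eq)

lemma upward_flow_0: "k < levels P \<Longrightarrow> x m k * e_prob P x m k = 0"
  by (cases "k = 0") (simp_all add: e_prob_0 interior del: e_prob.simps)

text \<open>The factor \<open>x m k\<close> vanishes except possibly for regular members at the top;
  if it is nonzero there, \<open>e_prob_levels\<close> kills the other factor.\<close>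

lemma downward_flow_0: "0 < k \<Longrightarrow> k \<le> levels P \<Longrightarrow> x m k * (1 - e_prob P x m k) = 0"
  using top[of m] e_prob_levels interior[of k m]
  by (cases "k = levels P"; cases "m = Regular") (auto simp del: e_prob.simps)

lemma rhs_eq_0:
  assumes "k \<le> levels P"
  shows "rhs P x m k = 0"
proof -
  consider "k = 0" | "0 < k" "k < levels P" | "k = levels P"
    using assms by linarith
  then show ?thesis
  proof cases
    case 1
    then show ?thesis
      using levels_pos upward_flow_0[of 0 m] downward_flow_0[of 1 m]
      by (auto simp: rhs_def simp del: e_prob.simps)
  next
    case 2
    then show ?thesis
      \<comment> \<open>The two inflows vanish by the flow lemmas, the outflow \<open>x m k\<close>
        by \<open>interior\<close>.\<close>
      using upward_flow_0[of "k - 1" m] downward_flow_0[of "k + 1" m]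
      by (auto simp: rhs_def interior simp del: e_prob.simps)
  next
    case 3
    then show ?thesis
      using levels_pos upward_flow_0[of "k - 1" m] downward_flow_0[of k m]
      by (auto simp: rhs_def simp del: e_prob.simps)
  qed
qed

text \<open>If \<open>p_c_doc\<close> is 0, then so is the top mass it multiplies; hence each
  endpoint mass counts in full, the type weights of regular members adding up to 1.\<close>

lemma p_correct_eq:
  "p_correct P x = x Regular 0 + x Regular (levels P) + x Clique 0 + x AntiClique 0"
  using levels_pos
  by (simp add: p_correct_def p_c_doc_eq p_m_doc_eq sum_state top) (simp add: algebra_simps)

end

theorem proposition6p1:
  fixes P :: params and R0 :: real and x :: state
  assumes "levels P \<ge> 3"
    and "alpha P \<in> {-1..1}" and "sigma P \<in> {-1..1}"
    and "gamma P \<in> {0..1}" and "p_lambda P \<in> {0..1/2}"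
    and "frac_cl P \<ge> 0" and "frac_acl P \<ge> 0" and "frac_cl P + frac_acl P \<le> 1"
    and "R0 \<in> {0..1 - frac_cl P - frac_acl P}"
    and "x Regular 0 = R0"
    and "x Regular (levels P) = 1 - frac_cl P - frac_acl P - R0"
    and "x Clique 0 = frac_cl P"
    and "x AntiClique 0 = frac_acl P"
    and "\<And>k. 0 < k \<Longrightarrow> k < levels P \<Longrightarrow> x Regular k = 0"
    and "\<And>k. 0 < k \<Longrightarrow> k \<le> levels P \<Longrightarrow> x Clique k = 0"
    and "\<And>k. 0 < k \<Longrightarrow> k \<le> levels P \<Longrightarrow> x AntiClique k = 0"
  shows "is_equilibrium P x \<and> p_correct P x = 1"
proof -
  interpret extreme_state P x
  proof
    show "x m k = 0" if "0 < k" "k < levels P" for m k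
      using that assms(14-16) by (cases m) auto
    show "x m (levels P) = 0" if "m \<noteq> Regular" for m
      using that assms(1,15,16) by (cases m) auto
  qed (use assms(1) in simp)
  \<comment> \<open>The upper bound on \<open>R0\<close> gives the sign of the regular mass at the
    top.\<close>
  have nonneg: "0 \<le> x m k" if k: "k \<le> levels P" for m k
  proof -
    consider "k = 0" | "0 < k" "k < levels P" | "k = levels P"
      using k by linarith
    then show ?thesis
      using assms(6,7,9-13) by cases (cases m; simp add: interior top)+
  qed
  have "x \<in> phase_space P"
    \<comment> \<open>Constant weight 1 turns each total mass into its two endpoint values.\<close>
    using nonneg sum_state[of _ "\<lambda>_. 1"] assms(10-13) by (simp add: phase_space_def top)
  then have "is_equilibrium P x"
    by (simp add: is_equilibrium_def rhs_eq_0)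
  moreover have "p_correct P x = 1"
    using assms(10-13) by (simp add: p_correct_eq)
  ultimately show ?thesis ..
qed

end
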